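(* There exists a maximum class of VC-dimension $3$ that has no corner. (That is, there exist a finite set $X$ and a concept class $C\subseteq 2^{X}$ which is maximum, has VC-dimension $3$, and contains no corner.)
   Context: Let $X$ be a finite set with $n=|X|$. A concept class is a family $C\subseteq 2^X$ of subsets of $X$ (concepts). For $Y\subseteq X$ let $C|Y=\{c\cap Y: c\in C\}$. A set $Y\subseteq X$ is shattered by $C$ if $C|Y=2^Y$. The VC-dimension of $C$ is the largest size $d$ of a set shattered by $C$. $C$ is maximum if $|C|=\sum_{i=0}^{d}\binom{n}{i}$, where $d$ is the VC-dimension of $C$. A cube of $2^X$ is a set of the form $B=\{T\cup Z: Z\subseteq Y\}$ with $Y\subseteq X$ and $T\subseteq X\setminus Y$; $Y$ is its support. A cube of $C$ is a cube $B$ of $2^X$ with $B\subseteq C$. A concept $c\in C$ is a corner of $C$ if $c$ belongs to exactly one inclusion-maximal cube of $C$. *)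

theory Defs
  imports Main
begin

definition restr :: "'a set set \<Rightarrow> 'a set \<Rightarrow> 'a set set" where
  "restr C Y = (\<lambda>c. c \<inter> Y) ` C"

definition shatters :: "'a set set \<Rightarrow> 'a set \<Rightarrow> bool" where
  "shatters C Y \<longleftrightarrow> restr C Y = Pow Y"

definition vc_dim :: "'a set \<Rightarrow> 'a set set \<Rightarrow> nat" where
  "vc_dim X C = Max {card Y | Y. Y \<subseteq> X \<and> shatters C Y}"

definition maximum_class :: "'a set \<Rightarrow> 'a set set \<Rightarrow> bool" where
  "maximum_class X C \<longleftrightarrow> card C = (\<Sum>i\<le>vc_dim X C. card X choose i)"

definition cube :: "'a set \<Rightarrow> 'a set set \<Rightarrow> bool" where
  "cube X B \<longleftrightarrow> (\<exists>Y T. Y \<subseteq> X \<and> T \<subseteq> X - Y \<and> B = {T \<union> Z | Z. Z \<subseteq> Y})"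

definition cube_of :: "'a set \<Rightarrow> 'a set set \<Rightarrow> 'a set set \<Rightarrow> bool" where
  "cube_of X C B \<longleftrightarrow> cube X B \<and> B \<subseteq> C"

definition maximal_cube_of :: "'a set \<Rightarrow> 'a set set \<Rightarrow> 'a set set \<Rightarrow> bool" where
  "maximal_cube_of X C B \<longleftrightarrow> cube_of X C B \<and> (\<forall>B'. cube_of X C B' \<and> B \<subseteq> B' \<longrightarrow> B' = B)"

definition corner :: "'a set \<Rightarrow> 'a set set \<Rightarrow> 'a set \<Rightarrow> bool" where
  "corner X C c \<longleftrightarrow> c \<in> C \<and> (\<exists>!B. maximal_cube_of X C B \<and> c \<in> B)"

end

theory Submission
  imports Defs
begin

text \<open>
  The class lives on 12 points and is a union of 92 three-dimensional cubes. A maximum class of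
  VC-dimension 3 has exactly one cube on each 3-element support, and it is determined by the
  signs telling on which side of each further element that cube lies. Being maximum is a
  constraint on the signs inside each 5-element set, and having no corner means that no cube is
  extremal in all three of its directions. Both conditions are propositional, and the class below
  is a solution, found by a SAT solver, with a cyclic symmetry of order 4. To check it, no 4-set
  is shattered, there are $299 = 1 + 12 + 66 + 220$ concepts, and every concept lies in at least
  two of the cubes. These are maximal because a larger cube would shatter a 4-set.
\<close>

section \<open>Encoding of cubes and classes by lists\<close>

text \<open>A list \<open>p\<close> encodes a cube on the points \<open>i, i + 1, \<dots>\<close>; \<open>Any\<close> marks its support.\<close>

datatype trit = Off | On | Any

fun cube_at :: "nat \<Rightarrow> trit list \<Rightarrow> nat set set" where
  "cube_at i [] = {{}}"
| "cube_at i (Off # p) = cube_at (Suc i) p"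
| "cube_at i (On # p) = insert i ` cube_at (Suc i) p"
| "cube_at i (Any # p) = cube_at (Suc i) p \<union> insert i ` cube_at (Suc i) p"

definition union_at :: "nat \<Rightarrow> trit list list \<Rightarrow> nat set set" where
  "union_at i P = \<Union> (cube_at i ` set P)"

text \<open>The two halves of a class at the first point, with that point deleted. A cube with
  \<open>Any\<close> there meets both halves. Different cubes may coincide after a split; they stay
  separate list entries, on which the multiplicities rely.\<close>

definition without :: "trit list list \<Rightarrow> trit list list" where
  "without P = map tl (filter (\<lambda>p. hd p \<noteq> On) P)"

definition with_first :: "trit list list \<Rightarrow> trit list list" where
  "with_first P = map tl (filter (\<lambda>p. hd p \<noteq> Off) P)"

text \<open>One entry for each concept in the union of the cubes: the number of list entries covering it.\<close>

fun mults :: "nat \<Rightarrow> trit list list \<Rightarrow> nat list" where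
  "mults 0 P = (if P = [] then [] else [length P])"
| "mults (Suc n) P = mults n (without P) @ mults n (with_first P)"

text \<open>
  A set containing the first point is shattered iff the rest of it is shattered both by the
  concepts avoiding and by those containing that point; hence the recursion on lists of classes,
  which asks for a set of at least \<open>k\<close> points shattered by all of them at once.
\<close>

fun unshattered :: "nat \<Rightarrow> nat \<Rightarrow> trit list list list \<Rightarrow> bool" where
  "unshattered n 0 L \<longleftrightarrow> [] \<in> set L"
| "unshattered 0 (Suc k) L \<longleftrightarrow> True"
| "unshattered (Suc n) (Suc k) L \<longleftrightarrow>
     [] \<in> set L \<or> unshattered n (Suc k) (map (map tl) L) \<and>
     unshattered n k (map without L @ map with_first L)"

section \<open>Encoded cubes: membership, injectivity and explicit form\<close>

lemma cube_at_subset: "c \<in> cube_at i p \<Longrightarrow> c \<subseteq> {i..<i + length p}"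
  by (induction i p arbitrary: c rule: cube_at.induct) fastforce+

lemma mem_insert_image:
  assumes "\<And>s. s \<in> S \<Longrightarrow> i \<notin> s"
  shows "c \<in> insert i ` S \<longleftrightarrow> i \<in> c \<and> c - {i} \<in> S"
proof
  assume "i \<in> c \<and> c - {i} \<in> S"
  then show "c \<in> insert i ` S"
    by (intro image_eqI[of _ _ "c - {i}"]) auto
qed (use assms in auto)

text \<open>Concepts over the tail never contain \<open>i\<close>, so the clauses of the recursion
  merge into one test that treats the head and the tail of the pattern separately.\<close>

lemma mem_cube_at_Cons:
  "c \<in> cube_at i (a # p) \<longleftrightarrow>
     c - {i} \<in> cube_at (Suc i) p \<and> (if i \<in> c then a \<noteq> Off else a \<noteq> On)"
proof -
  have notin: "i \<notin> c'" if "c' \<in> cube_at (Suc i) p" for c'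
    using cube_at_subset[OF that] by auto
  have ins: "c \<in> insert i ` cube_at (Suc i) p \<longleftrightarrow> i \<in> c \<and> c - {i} \<in> cube_at (Suc i) p"
    using notin by (rule mem_insert_image)
  have "c - {i} = c" if "i \<notin> c"
    using that by simp
  with ins notin show ?thesis
    by (cases a) auto
qed

lemma cube_at_nonempty: "cube_at i p \<noteq> {}"
  by (induction i p rule: cube_at.induct) auto

lemma cube_at_tail: "(\<lambda>c. c - {i}) ` cube_at i (a # p) = cube_at (Suc i) p"
proof (intro equalityI subsetI)
  fix c assume c: "c \<in> cube_at (Suc i) p"
  then have "i \<notin> c"
    using cube_at_subset by fastforce
  \<comment> \<open>The preimage of \<open>c\<close> is taken on a side of \<open>i\<close> that the
    entry \<open>a\<close> permits.\<close>
  then have "(if a = On then insert i c else c) \<in> cube_at i (a # p)"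
    "c = (if a = On then insert i c else c) - {i}"
    using c by (auto simp: mem_cube_at_Cons)
  then show "c \<in> (\<lambda>c. c - {i}) ` cube_at i (a # p)"
    by blast
qed (auto simp: mem_cube_at_Cons)

text \<open>Since the cube of the tail is nonempty, each side of \<open>i\<close> permitted by the
  head really contains a concept; hence the cube determines its head entry.\<close>

lemma cube_at_head:
  "a \<noteq> Off \<longleftrightarrow> (\<exists>c \<in> cube_at i (a # p). i \<in> c)"
  "a \<noteq> On \<longleftrightarrow> (\<exists>c \<in> cube_at i (a # p). i \<notin> c)"
proof -
  obtain c where c: "c \<in> cube_at (Suc i) p"
    using cube_at_nonempty by blast
  then have "i \<notin> c"
    using cube_at_subset by fastforce
  with c have "a \<noteq> Off \<Longrightarrow> insert i c \<in> cube_at i (a # p)" "a \<noteq> On \<Longrightarrow> c \<in> cube_at i (a # p)"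
    by (auto simp: mem_cube_at_Cons)
  with \<open>i \<notin> c\<close> have "a \<noteq> Off \<Longrightarrow> \<exists>c \<in> cube_at i (a # p). i \<in> c"
    "a \<noteq> On \<Longrightarrow> \<exists>c \<in> cube_at i (a # p). i \<notin> c"
    by blast+
  moreover have "c' \<in> cube_at i (a # p) \<Longrightarrow> i \<in> c' \<Longrightarrow> a \<noteq> Off"
    "c' \<in> cube_at i (a # p) \<Longrightarrow> i \<notin> c' \<Longrightarrow> a \<noteq> On" for c'
    unfolding mem_cube_at_Cons by simp_all
  ultimately show "a \<noteq> Off \<longleftrightarrow> (\<exists>c \<in> cube_at i (a # p). i \<in> c)"
    "a \<noteq> On \<longleftrightarrow> (\<exists>c \<in> cube_at i (a # p). i \<notin> c)"
    by blast+
qed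

text \<open>Head and tail can both be read off the cube. Equal lengths matter: \<open>[]\<close> and
  \<open>[Off]\<close> encode the same cube. This turns different list entries into different
  maximal cubes.\<close>

lemma cube_at_inject: "length p = length q \<Longrightarrow> cube_at i p = cube_at i q \<Longrightarrow> p = q"
proof (induction p q arbitrary: i rule: list_induct2)
  case (Cons a p b q)
  have "a = Off \<longleftrightarrow> b = Off" "a = On \<longleftrightarrow> b = On"
    using cube_at_head[of a i p, unfolded Cons.prems] cube_at_head[of b i q] by argo+
  then have "a = b"
    by (metis trit.exhaust)
  moreover have "cube_at (Suc i) p = cube_at (Suc i) q"
    using Cons.prems cube_at_tail by metis
  ultimately show ?case
    using Cons.IH by simp
qed simp

text \<open>Translates the encoding into the form used by \<open>cube\<close>: the support collects
  the \<open>Any\<close> positions and the base set the \<open>On\<close> positions.\<close>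

lemma cube_at_form:
  "\<exists>Y T. Y \<subseteq> {i..<i + length p} \<and> T \<subseteq> {i..<i + length p} - Y \<and>
     card Y = length (filter (\<lambda>t. t = Any) p) \<and> cube_at i p = {T \<union> Z | Z. Z \<subseteq> Y}"
proof (induction p arbitrary: i)
  case (Cons a p)
  let ?R = "{Suc i..<Suc i + length p}"
  have R: "{i..<i + length (a # p)} = insert i ?R" "i \<notin> ?R"
    by (simp_all add: set_eq_iff) presburger
  obtain Y T where YT: "Y \<subseteq> ?R" "T \<subseteq> ?R - Y"
    "card Y = length (filter (\<lambda>t. t = Any) p)" "cube_at (Suc i) p = {T \<union> Z | Z. Z \<subseteq> Y}"
    using Cons.IH[of "Suc i"] by (elim exE conjE) (rule that)
  let ?Y = "if a = Any then insert i Y else Y" and ?T = "if a = On then insert i T else T"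
  have "finite Y" "i \<notin> Y"
    using finite_subset[OF YT(1)] YT(1) R(2) by auto
  then have "card ?Y = length (filter (\<lambda>t. t = Any) (a # p))"
    using YT(3) by simp
  moreover have "cube_at i (a # p) = {?T \<union> Z | Z. Z \<subseteq> ?Y}"
  proof (cases a)
    case Off
    then show ?thesis
      using YT(4) by simp
  next
    case On
    have "insert i ` {T \<union> Z | Z. Z \<subseteq> Y} = {insert i T \<union> Z | Z. Z \<subseteq> Y}"
      by (simp add: setcompr_eq_image image_image)
    then show ?thesis
      using On YT(4) by simp
  next
    case Any
    \<comment> \<open>The subsets of \<open>insert i Y\<close> are those of \<open>Y\<close>,
      without and with \<open>i\<close> added; these give the two halves of the cube.\<close>
    have "{T \<union> Z | Z. Z \<subseteq> insert i Y} = (\<union>) T ` Pow (insert i Y)"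
      by blast
    also have "\<dots> = (\<union>) T ` Pow Y \<union> insert i ` (\<union>) T ` Pow Y"
      unfolding Pow_insert image_Un image_image by simp
    also have "(\<union>) T ` Pow Y = cube_at (Suc i) p"
      unfolding YT(4) by blast
    finally show ?thesis
      using Any by simp
  qed
  moreover have "?Y \<subseteq> insert i ?R" "?T \<subseteq> insert i ?R - ?Y"
    using YT(1,2) R(2) by (auto split: if_splits)
  ultimately show ?case
    unfolding R(1) by blast
qed simp

section \<open>Splitting and projecting a union of cubes at its first point\<close>

lemma union_at_subset:
  "\<forall>p \<in> set L. length p = n \<Longrightarrow> c \<in> union_at i L \<Longrightarrow> c \<subseteq> {i..<i + n}"
  unfolding union_at_def using cube_at_subset by fastforce

lemma finite_union_at: "\<forall>p \<in> set L. length p = n \<Longrightarrow> finite (union_at i L)"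
  by (rule finite_subset[of _ "Pow {i..<i + n}"]) (use union_at_subset in blast, simp)

lemma mem_union_at:
  assumes "\<forall>p \<in> set L. length p = Suc n"
  shows "c \<in> union_at i L \<longleftrightarrow>
    (if i \<in> c then c - {i} \<in> union_at (Suc i) (with_first L) else c \<in> union_at (Suc i) (without L))"
proof -
  have "c \<in> cube_at i p \<longleftrightarrow>
      c - {i} \<in> cube_at (Suc i) (tl p) \<and> (if i \<in> c then hd p \<noteq> Off else hd p \<noteq> On)"
    if "p \<in> set L" for p
    using assms that mem_cube_at_Cons[of c i "hd p" "tl p"] by (cases p) auto
  then show ?thesis
    unfolding union_at_def with_first_def without_def by auto
qed

text \<open>Dropping the heads deletes \<open>i\<close> from every concept. This is the projection
  used for sets \<open>Y\<close> that avoid \<open>i\<close>.\<close>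

lemma union_at_tails:
  assumes "\<forall>p \<in> set L. length p = Suc n"
  shows "union_at (Suc i) (map tl L) = (\<lambda>c. c - {i}) ` union_at i L"
proof -
  have "cube_at (Suc i) (tl p) = (\<lambda>c. c - {i}) ` cube_at i p" if "p \<in> set L" for p
    using assms that cube_at_tail[of i "hd p" "tl p"] by (cases p) auto
  then show ?thesis
    unfolding union_at_def by auto
qed

lemma length_splits:
  assumes "\<forall>p \<in> set L. length p = Suc n"
  shows "\<forall>p \<in> set (without L). length p = n" "\<forall>p \<in> set (with_first L). length p = n"
    "\<forall>p \<in> set (map tl L). length p = n"
  using assms unfolding without_def with_first_def by auto

section \<open>Shattering, and soundness of the recursive test\<close>

lemma shatters_iff: "shatters C Y \<longleftrightarrow> (\<forall>Z \<subseteq> Y. \<exists>c \<in> C. c \<inter> Y = Z)"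
proof -
  have "restr C Y \<subseteq> Pow Y"
    unfolding restr_def by blast
  then have "shatters C Y \<longleftrightarrow> (\<forall>Z \<in> Pow Y. Z \<in> restr C Y)"
    unfolding shatters_def by blast
  then show ?thesis
    unfolding restr_def image_iff Ball_def Pow_iff by (simp only: eq_commute)
qed

text \<open>For \<open>Z\<close> inside \<open>Y - {i}\<close>, a concept with trace
  \<open>Z\<close> on \<open>Y\<close> lies in the half without \<open>i\<close>, and one with trace
  \<open>insert i Z\<close> in the half with \<open>i\<close>.\<close>

lemma shatters_union_at_splits:
  assumes len: "\<forall>p \<in> set L. length p = Suc n"
    and sh: "shatters (union_at i L) Y" and i: "i \<in> Y"
  shows "shatters (union_at (Suc i) (without L)) (Y - {i})"
    "shatters (union_at (Suc i) (with_first L)) (Y - {i})"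
proof -
  show "shatters (union_at (Suc i) (without L)) (Y - {i})"
    unfolding shatters_iff
  proof (intro allI impI)
    fix Z assume Z: "Z \<subseteq> Y - {i}"
    then obtain c where c: "c \<in> union_at i L" "c \<inter> Y = Z"
      using sh unfolding shatters_iff by blast
    then have "i \<notin> c"
      using i Z by blast
    then have "c \<in> union_at (Suc i) (without L)" "c \<inter> (Y - {i}) = Z"
      using c mem_union_at[OF len] by auto
    then show "\<exists>c \<in> union_at (Suc i) (without L). c \<inter> (Y - {i}) = Z"
      by blast
  qed
  show "shatters (union_at (Suc i) (with_first L)) (Y - {i})"
    unfolding shatters_iff
  proof (intro allI impI)
    fix Z assume Z: "Z \<subseteq> Y - {i}"
    then have "insert i Z \<subseteq> Y"
      using i by blast
    then obtain c where c: "c \<in> union_at i L" "c \<inter> Y = insert i Z"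
      using sh unfolding shatters_iff by blast
    then have "i \<in> c"
      by blast
    then have "c - {i} \<in> union_at (Suc i) (with_first L)" "(c - {i}) \<inter> (Y - {i}) = Z"
      using c Z mem_union_at[OF len, of c i] by auto
    then show "\<exists>c \<in> union_at (Suc i) (with_first L). c \<inter> (Y - {i}) = Z"
      by blast
  qed
qed

text \<open>Even the empty set needs a concept to realise its only subset.\<close>

lemma not_shatters_empty: "\<not> shatters (union_at i []) Y"
  by (auto simp: shatters_iff union_at_def)

text \<open>Induction along the test: if \<open>i\<close> lies in \<open>Y\<close>, it is removed,
  \<open>k\<close> drops by one and each class is replaced by its two halves; otherwise all classes
  are projected and \<open>k\<close> stays.\<close>

lemma unshattered_sound:
  assumes "unshattered n k LL" "\<forall>L \<in> set LL. \<forall>p \<in> set L. length p = n"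
    "Y \<subseteq> {i..<i + n}" "k \<le> card Y"
  shows "\<exists>L \<in> set LL. \<not> shatters (union_at i L) Y"
  using assms
proof (induction n k LL arbitrary: i Y rule: unshattered.induct)
  case (1 n LL)
  then have "[] \<in> set LL"
    by simp
  then show ?case
    using not_shatters_empty by blast
next
  case (2 k LL)
  \<comment> \<open>No points remain, so \<open>Y\<close> is empty and cannot have
    \<open>Suc k\<close> elements.\<close>
  then show ?case
    by simp
next
  case (3 n k LL)
  have len: "\<forall>p \<in> set L. length p = Suc n" if "L \<in> set LL" for L
    using 3(4) that by blast
  have R: "{i..<i + Suc n} - {i} = {Suc i..<Suc i + n}"
    by (simp add: set_eq_iff) presburger
  show ?case
  proof (cases "[] \<in> set LL")
    case True
    then show ?thesis
      using not_shatters_empty by blast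
  next
    case False
    then have uns: "unshattered n (Suc k) (map (map tl) LL)"
      "unshattered n k (map without LL @ map with_first LL)"
      using 3(3) by auto
    show ?thesis
    proof (cases "i \<in> Y")
      case True
      have "finite Y"
        using finite_subset[OF 3(5)] by simp
      then have "k \<le> card (Y - {i})"
        using 3(6) True by simp
      moreover have "Y - {i} \<subseteq> {Suc i..<Suc i + n}"
        using 3(5) R by blast
      moreover have "\<forall>L \<in> set (map without LL @ map with_first LL). \<forall>p \<in> set L. length p = n"
        using length_splits(1,2)[OF len] by auto
      ultimately obtain L where "L \<in> set (map without LL @ map with_first LL)"
        "\<not> shatters (union_at (Suc i) L) (Y - {i})"
        using 3(2)[OF uns(2)] by blast
      then show ?thesis
        using shatters_union_at_splits[OF len _ True] by auto
    next
      case False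
      then have "Y \<subseteq> {Suc i..<Suc i + n}"
        using 3(5) R by blast
      moreover have "\<forall>L \<in> set (map (map tl) LL). \<forall>p \<in> set L. length p = n"
        using length_splits(3)[OF len] by auto
      ultimately obtain L where L: "L \<in> set LL" "\<not> shatters (union_at (Suc i) (map tl L)) Y"
        using 3(1)[OF uns(1) _ _ 3(6), of "Suc i"] by auto
      \<comment> \<open>As \<open>i\<close> is outside \<open>Y\<close>, the projection preserves
        all traces on \<open>Y\<close>.\<close>
      have "(c - {i}) \<inter> Y = c \<inter> Y" for c
        using False by blast
      then have "\<not> shatters (union_at i L) Y"
        using L by (auto simp: shatters_iff union_at_tails[OF len])
      with L show ?thesis
        by blast
    qed
  qed
qed

section \<open>Counting concepts and the cubes that cover them\<close>

lemma union_at_split: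
  assumes "\<forall>p \<in> set L. length p = Suc n"
  shows "union_at i L =
    union_at (Suc i) (without L) \<union> insert i ` union_at (Suc i) (with_first L)"
proof -
  have notin: "i \<notin> c" if "c \<in> union_at (Suc i) (without L) \<or> c \<in> union_at (Suc i) (with_first L)" for c
    using that union_at_subset[OF length_splits(1)[OF assms], of c "Suc i"]
      union_at_subset[OF length_splits(2)[OF assms], of c "Suc i"] by fastforce
  have ins: "c \<in> insert i ` union_at (Suc i) (with_first L) \<longleftrightarrow>
      i \<in> c \<and> c - {i} \<in> union_at (Suc i) (with_first L)" for c
    using notin by (intro mem_insert_image) blast
  show ?thesis
    using mem_union_at[OF assms] ins notin by (auto split: if_splits)
qed

text \<open>The halves are disjoint and adding \<open>i\<close> is injective on the second, so their
  sizes add up. Overlaps of cubes are not counted twice, because a nonempty leaf of the recursion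
  yields a single entry.\<close>

lemma length_mults: "\<forall>p \<in> set L. length p = n \<Longrightarrow> length (mults n L) = card (union_at i L)"
proof (induction n arbitrary: i L)
  case 0
  then have "union_at i L = (if L = [] then {} else {{}})"
    by (cases L) (auto simp: union_at_def)
  then show ?case
    by simp
next
  case (Suc n)
  note len = length_splits[OF Suc.prems]
  let ?A = "union_at (Suc i) (without L)" and ?B = "union_at (Suc i) (with_first L)"
  have notin: "i \<notin> c" if "c \<in> ?A \<union> ?B" for c
    using that union_at_subset[OF len(1), of c "Suc i"] union_at_subset[OF len(2), of c "Suc i"]
    by fastforce
  then have "inj_on (insert i) ?B"
    by (auto intro!: inj_onI dest: insert_ident)
  moreover have "?A \<inter> insert i ` ?B = {}"
    using notin by auto
  ultimately show ?case
    using Suc.IH[OF len(1)] Suc.IH[OF len(2)] finite_union_at[OF len(1)] finite_union_at[OF len(2)]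
    by (simp add: union_at_split[OF Suc.prems] card_Un_disjoint card_image)
qed

text \<open>Following \<open>c\<close> through the splits keeps exactly the patterns that still
  agree with \<open>c\<close>; the length of the list at the leaf is the multiplicity of
  \<open>c\<close>.\<close>

lemma multiplicity_in_mults:
  "\<forall>p \<in> set L. length p = n \<Longrightarrow> c \<in> union_at i L \<Longrightarrow>
     length (filter (\<lambda>p. c \<in> cube_at i p) L) \<in> set (mults n L)"
proof (induction n arbitrary: i c L)
  case 0
  then have "\<forall>p \<in> set L. cube_at i p = {{}}" "c = {}" "L \<noteq> []"
    by (auto simp: union_at_def)
  then show ?case
    by simp
next
  case (Suc n)
  note len = length_splits[OF Suc.prems(1)]
  have mem: "c \<in> cube_at i p \<longleftrightarrow>
      c - {i} \<in> cube_at (Suc i) (tl p) \<and> (if i \<in> c then hd p \<noteq> Off else hd p \<noteq> On)"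
    if "p \<in> set L" for p
    using Suc.prems that mem_cube_at_Cons[of c i "hd p" "tl p"] by (cases p) auto
  let ?L = "if i \<in> c then with_first L else without L"
  have "filter (\<lambda>p. c \<in> cube_at i p) L =
      filter (\<lambda>p. c - {i} \<in> cube_at (Suc i) (tl p) \<and> (if i \<in> c then hd p \<noteq> Off else hd p \<noteq> On)) L"
    using mem by (intro filter_cong) auto
  then have "length (filter (\<lambda>p. c \<in> cube_at i p) L) =
      length (filter (\<lambda>p. c - {i} \<in> cube_at (Suc i) p) ?L)"
    by (auto simp: with_first_def without_def filter_map o_def conj_commute)
  moreover have "c - {i} \<in> union_at (Suc i) ?L"
    using Suc.prems(2) mem_union_at[OF Suc.prems(1)] by (auto split: if_splits)
  ultimately show ?case
    using Suc.IH[OF len(1)] Suc.IH[OF len(2)] by (auto split: if_splits)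
qed

section \<open>Maximality of cubes of top dimension\<close>

lemma card_cube:
  assumes "finite Y" "T \<inter> Y = {}"
  shows "card {T \<union> Z | Z. Z \<subseteq> Y} = 2 ^ card Y"
proof -
  have "{T \<union> Z | Z. Z \<subseteq> Y} = (\<union>) T ` Pow Y"
    by auto
  moreover have "inj_on ((\<union>) T) (Pow Y)"
    using assms(2) by (intro inj_onI) blast
  ultimately show ?thesis
    by (simp add: card_image card_Pow assms(1))
qed

lemma cube_shatters:
  assumes "{T \<union> Z | Z. Z \<subseteq> Y} \<subseteq> C" "T \<inter> Y = {}"
  shows "shatters C Y"
  unfolding shatters_iff
proof (intro allI impI)
  fix Z assume "Z \<subseteq> Y"
  then have "T \<union> Z \<in> C" "(T \<union> Z) \<inter> Y = Z"
    using assms by blast+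
  then show "\<exists>c \<in> C. c \<inter> Y = Z"
    by blast
qed

text \<open>A cube of the class shatters its own support, so it has at most \<open>2 ^ d\<close>
  concepts. A cube containing one with \<open>2 ^ d\<close> concepts therefore equals it.\<close>

lemma maximal_cube_of_top_dim:
  assumes X: "finite X" and vc: "\<And>Y. Y \<subseteq> X \<Longrightarrow> shatters C Y \<Longrightarrow> card Y \<le> d"
    and YT: "Y \<subseteq> X" "T \<subseteq> X - Y" and d: "card Y = d" and sub: "{T \<union> Z | Z. Z \<subseteq> Y} \<subseteq> C"
  shows "maximal_cube_of X C {T \<union> Z | Z. Z \<subseteq> Y}" (is "maximal_cube_of X C ?B")
  unfolding maximal_cube_of_def
proof (intro conjI allI impI)
  show "cube_of X C ?B"
    unfolding cube_of_def cube_def using YT sub by (intro conjI exI[of _ Y] exI[of _ T]) simp_all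
  fix B' assume B': "cube_of X C B' \<and> ?B \<subseteq> B'"
  then have "cube X B'" and BC: "B' \<subseteq> C"
    unfolding cube_of_def by simp_all
  then obtain Y' T' where YT': "Y' \<subseteq> X" "T' \<subseteq> X - Y'" "B' = {T' \<union> Z | Z. Z \<subseteq> Y'}"
    unfolding cube_def by (elim exE conjE) (rule that)
  have fin: "finite Y" "finite Y'"
    using finite_subset[OF YT(1) X] finite_subset[OF YT'(1) X] by auto
  have "card B' = 2 ^ card Y'"
    unfolding YT'(3) using fin(2) YT'(2) by (intro card_cube) auto
  also have "\<dots> \<le> 2 ^ d"
    using vc[OF YT'(1) cube_shatters[of T' Y' C]] YT'(2,3) BC by (intro power_increasing) auto
  also have "\<dots> = card ?B"
    unfolding d[symmetric] using fin(1) YT(2) by (intro card_cube[symmetric]) auto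
  finally have "card B' \<le> card ?B" .
  moreover have "finite B'"
    unfolding YT'(3) using fin(2) by simp
  ultimately show "B' = ?B"
    using card_seteq[of B' ?B] B' by simp
qed

section \<open>The concrete class and its verification\<close>

definition generators :: "trit list list" where
  "generators =
    [[Any,Any,Any,Off,Off,On,Off,Off,Off,Off,Off,On],
     [Any,Any,On,On,Any,Off,Off,Off,Off,Off,On,Off],
     [Any,Any,On,On,Off,Off,Off,Off,Off,Off,Any,On],
     [Any,Any,On,On,On,Off,Any,Off,On,Off,On,Off],
     [Any,Off,Any,Off,On,Off,Any,On,On,On,On,Off],
     [Any,Off,Off,Off,Any,Off,On,On,On,On,On,Any],
     [Any,Off,Off,Off,Off,Any,Off,Any,On,On,Off,On],
     [Any,Off,Off,Off,Off,Off,Off,Any,On,On,On,Any],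
     [Any,Off,Off,Off,Off,On,Off,On,Any,Any,Off,On],
     [Any,Off,On,Any,Off,On,Off,Off,Any,Off,Off,On],
     [Any,Off,On,Any,On,Off,Any,Off,On,Off,On,Off],
     [Any,Off,On,Off,Off,Off,Off,Off,On,Any,On,Any],
     [Any,Off,On,On,Any,Off,Off,Off,Any,Off,On,Off],
     [Any,Off,On,On,Off,Any,Off,Off,Any,Off,Off,On],
     [Any,On,On,On,On,Any,On,Off,Off,Off,Any,Off],
     [Off,Any,Any,Off,Any,On,On,Off,Off,Off,Off,Off],
     [Off,Any,Any,Off,Off,On,On,Off,Off,Off,Off,Any],
     [Off,Any,Any,On,On,On,On,Off,Any,Off,Off,Off],
     [Off,Any,Off,Off,Any,On,On,On,On,On,Off,Any],
     [Off,Any,Off,Off,Off,On,On,On,Any,On,Off,Any],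
     [Off,Any,Off,On,On,On,On,Any,Any,Off,Off,Off],
     [Off,Any,On,On,Any,Any,Off,Off,Off,Off,Off,Off],
     [Off,Any,On,On,On,Any,On,Off,Any,Off,On,Off]]"

text \<open>The symmetry shifts the 12 points cyclically by 3.\<close>

definition cubes :: "trit list list" where
  "cubes = concat (map (\<lambda>k. map (rotate (3 * k)) generators) [0, 1, 2, 3])"

text \<open>The 23 generators have disjoint orbits of full size 4, which gives the 92 cubes. Without
  repetitions, the multiplicities count different cubes.\<close>

lemma distinct_cubes: "distinct cubes"
  by code_simp

lemma shape_cubes: "list_all (\<lambda>p. length p = 12 \<and> length (filter (\<lambda>t. t = Any) p) = 3) cubes"
  by code_simp

lemma mults_cubes: "length (mults 12 cubes) = 299 \<and> list_all (\<lambda>m. 2 \<le> m) (mults 12 cubes)"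
  by code_simp

lemma unshattered_cubes: "unshattered 12 4 [cubes]"
  by code_simp

theorem theorem4p5:
  shows "\<exists>(X::nat set) C. finite X \<and> C \<subseteq> Pow X \<and> maximum_class X C \<and>
           vc_dim X C = 3 \<and> (\<forall>c\<in>C. \<not> corner X C c)"
proof -
  let ?X = "{0..<12::nat}"
  let ?C = "union_at 0 cubes"
  have len: "\<forall>p \<in> set cubes. length p = 12"
    and dim: "\<forall>p \<in> set cubes. length (filter (\<lambda>t. t = Any) p) = 3"
    using shape_cubes by (auto simp: list_all_iff)
  have sub: "?C \<subseteq> Pow ?X"
    using union_at_subset[OF len] by fastforce
  have vc_le: "card Y \<le> 3" if "Y \<subseteq> ?X" "shatters ?C Y" for Y
    using unshattered_sound[OF unshattered_cubes, of Y 0] that len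
    by (cases "4 \<le> card Y") auto
  have max: "maximal_cube_of ?X ?C (cube_at 0 p)" if p: "p \<in> set cubes" for p
  proof -
    obtain Y T where "Y \<subseteq> ?X" "T \<subseteq> ?X - Y" "card Y = 3"
      "cube_at 0 p = {T \<union> Z | Z. Z \<subseteq> Y}"
      using cube_at_form[of 0 p] len dim p by auto
    moreover have "cube_at 0 p \<subseteq> ?C"
      using p by (auto simp: union_at_def)
    ultimately show ?thesis
      using maximal_cube_of_top_dim[of ?X ?C 3 Y T] vc_le by simp
  qed
  have vc: "vc_dim ?X ?C = 3"
    unfolding vc_dim_def
  proof (rule Max_eqI)
    show "finite {card Y | Y. Y \<subseteq> ?X \<and> shatters ?C Y}"
      by (rule finite_subset[of _ "{..3}"]) (use vc_le in auto)
    show "y \<le> 3" if "y \<in> {card Y | Y. Y \<subseteq> ?X \<and> shatters ?C Y}" for y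
      using that vc_le by auto
    \<comment> \<open>Any listed cube shows that the bound 3 is attained, by shattering its
      support.\<close>
    obtain p where p: "p \<in> set cubes"
      by (auto simp: cubes_def generators_def)
    obtain Y T where YT: "Y \<subseteq> ?X" "T \<subseteq> ?X - Y" "card Y = 3"
      "cube_at 0 p = {T \<union> Z | Z. Z \<subseteq> Y}"
      using cube_at_form[of 0 p] len dim p by auto
    have "cube_at 0 p \<subseteq> ?C"
      using p by (auto simp: union_at_def)
    then have "shatters ?C Y"
      using YT by (intro cube_shatters[of T]) auto
    with YT show "3 \<in> {card Y | Y. Y \<subseteq> ?X \<and> shatters ?C Y}"
      by (intro CollectI exI[of _ Y]) simp
  qed
  have "card ?C = 299"
    using length_mults[OF len] mults_cubes by metis
  also have "\<dots> = (\<Sum>i\<le>3. card ?X choose i)"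
    by (simp add: numeral_eq_Suc)
  finally have "maximum_class ?X ?C"
    unfolding maximum_class_def vc .
  moreover have "\<not> corner ?X ?C c" if c: "c \<in> ?C" for c
  proof
    assume "corner ?X ?C c"
    then obtain B where unique: "\<And>B'. maximal_cube_of ?X ?C B' \<Longrightarrow> c \<in> B' \<Longrightarrow> B' = B"
      unfolding corner_def by blast
    let ?F = "filter (\<lambda>p. c \<in> cube_at 0 p) cubes"
    have "2 \<le> length ?F"
      using multiplicity_in_mults[OF len c] mults_cubes by (auto simp: list_all_iff)
    moreover have "card (set ?F) = length ?F"
      using distinct_cubes by (intro distinct_card) simp
    \<comment> \<open>All patterns covering \<open>c\<close> encode maximal cubes through
      \<open>c\<close>, hence the same cube \<open>B\<close>, and by injectivity they coincide; this
      contradicts multiplicity at least 2.\<close>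
    moreover have "p = q" if "p \<in> set ?F" "q \<in> set ?F" for p q
      using that unique max len cube_at_inject[of p q 0] by auto
    then have "card (set ?F) \<le> Suc 0"
      by (intro card_le_Suc0_iff_eq[THEN iffD2]) auto
    ultimately show False
      by simp
  qed
  ultimately show ?thesis
    using sub vc by (intro exI[of _ ?X] exI[of _ ?C]) simp
qed

end
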